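(* The log-normal relaxation spectrum (Gaussian in the variable $\ln\tau$) $$H_{\mathrm{LN}}(\tau)=\frac{1}{\sqrt{2\pi\sigma^2}}\exp\!\left(-\frac{(\ln\tau-\mu)^2}{2\sigma^2}\right),\qquad\tau>0,$$ has Mellin transform $$\tilde H_{\mathrm{LN}}(s)=\exp\!\left(\mu s+\frac{\sigma^2}{2}s^2\right),$$ which is entire of order $2$. Consequently, $H_{\mathrm{LN}}(\tau)$ is not in the finite Prony class $\mathcal P$ and therefore belongs to the transcendental class.
   Context: Here $\mu\in\mathbb R$ and $\sigma^2>0$. The Mellin transform is $\tilde H(s)=\int_0^\infty\tau^{s-1}H(\tau)\,d\tau$. Discrete (finite) Prony class $\mathcal P$: functions $\tilde H(s)=\sum_{k=1}^Ng_ke^{\lambda_ks}$ with $N<\infty$, $g_k>0$, $\lambda_k\in\mathbb R$; equivalently spectra $H(\tau)=\sum_{k=1}^Ng_k\tau_k\,\delta(\tau-\tau_k)$ with $\tau_k=e^{\lambda_k}$. A spectrum is said to be in $\mathcal P$ if its Mellin transform is. Extended Fox class $\mathcal Q$: functions $H_\Gamma(s)\exp(P(s))$ with $P$ entire and $H_\Gamma(s)=\prod_{i=1}^N\Gamma(a_is+b_i)\big/\prod_{j=1}^M\Gamma(c_js+d_j)$, $a_i,c_j>0$, $N,M<\infty$. The transcendental class is $\mathcal Q\setminus\mathcal P$ (spectra not represented by any finite Prony series, requiring an infinite sum $\sum_{k}g_k\tau_k\,\delta(\tau-\tau_k)$, an infinite Prony ladder). *)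

theory Defs
  imports "HOL-Analysis.Analysis" "HOL-Complex_Analysis.Complex_Analysis"
begin

(* For \<tau> > 0, of_real \<tau> powr (s - 1) is the principal power exp ((s - 1) * ln \<tau>). *)

definition mellin_converges :: "(real \<Rightarrow> real) \<Rightarrow> complex \<Rightarrow> bool" where
  "mellin_converges H s \<longleftrightarrow>
     set_integrable lborel {0<..} (\<lambda>\<tau>. complex_of_real \<tau> powr (s - 1) * complex_of_real (H \<tau>))"

definition mellin :: "(real \<Rightarrow> real) \<Rightarrow> complex \<Rightarrow> complex" where
  "mellin H s = (LINT \<tau>:{0<..}|lborel. complex_of_real \<tau> powr (s - 1) * complex_of_real (H \<tau>))"

(* Since spectra may contain Dirac masses, a spectrum is a Borel measure M, which stands for
   H(\<tau>) d\<tau>. Only its restriction to the positive half-line matters. *)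

definition spectrum_mellin_converges :: "real measure \<Rightarrow> complex \<Rightarrow> bool" where
  "spectrum_mellin_converges M s \<longleftrightarrow> set_integrable M {0<..} (\<lambda>\<tau>. complex_of_real \<tau> powr (s - 1))"

definition spectrum_mellin :: "real measure \<Rightarrow> complex \<Rightarrow> complex" where
  "spectrum_mellin M s = (LINT \<tau>:{0<..}|M. complex_of_real \<tau> powr (s - 1))"

(* Meant for H \<ge> 0 on the positive half-line, as ennreal sends negative reals to 0. *)

definition function_spectrum :: "(real \<Rightarrow> real) \<Rightarrow> real measure" where
  "function_spectrum H = density lborel (\<lambda>\<tau>. ennreal (H \<tau>))"

(* The finite sum over k < N of g k * \<tau>\<^sub>k * \<delta>(\<tau> - \<tau>\<^sub>k), where \<tau>\<^sub>k = exp (l k). *)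

definition discrete_spectrum :: "nat \<Rightarrow> (nat \<Rightarrow> real) \<Rightarrow> (nat \<Rightarrow> real) \<Rightarrow> real measure" where
  "discrete_spectrum N g l =
     distr (point_measure {..<N} (\<lambda>k. ennreal (g k * exp (l k)))) borel (\<lambda>k. exp (l k))"

definition prony_class :: "(complex \<Rightarrow> complex) set" where
  "prony_class = {F. \<exists>(N::nat) (g::nat \<Rightarrow> real) (l::nat \<Rightarrow> real).
     (\<forall>k<N. g k > 0) \<and>
     F = (\<lambda>s. \<Sum>k<N. complex_of_real (g k) * exp (complex_of_real (l k) * s))}"

(* At a pole of a denominator factor the library's Gamma is 0, and division by 0 gives 0, so that
   1 / Gamma has its correct value 0 there. At the poles of numerator factors the value is the
   conventional 0 of the library. *)

definition gamma_quotient ::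
  "nat \<Rightarrow> (nat \<Rightarrow> real) \<Rightarrow> (nat \<Rightarrow> complex) \<Rightarrow> nat \<Rightarrow> (nat \<Rightarrow> real) \<Rightarrow> (nat \<Rightarrow> complex) \<Rightarrow> complex \<Rightarrow> complex"
where
  "gamma_quotient N a b M c d s =
     (\<Prod>i<N. Gamma (complex_of_real (a i) * s + b i)) /
     (\<Prod>j<M. Gamma (complex_of_real (c j) * s + d j))"

definition fox_class :: "(complex \<Rightarrow> complex) set" where
  "fox_class = {F. \<exists>(N::nat) a b (M::nat) c d P.
     (\<forall>i<N. a i > 0) \<and> (\<forall>j<M. c j > 0) \<and> P holomorphic_on UNIV \<and>
     F = (\<lambda>s. gamma_quotient N a b M c d s * exp (P s))}"

(* The Mellin integral converges in general only on a vertical strip, whereas the members of the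
   two classes are functions on the whole plane. A spectrum belongs to a class if its transform
   converges on some nonempty open strip and agrees there with a member of the class. *)

definition spectrum_in :: "(complex \<Rightarrow> complex) set \<Rightarrow> real measure \<Rightarrow> bool" where
  "spectrum_in C M \<longleftrightarrow> (\<exists>F\<in>C. \<exists>\<alpha> \<beta>. \<alpha> < \<beta> \<and>
     (\<forall>s. \<alpha> < Re s \<and> Re s < \<beta> \<longrightarrow> spectrum_mellin_converges M s \<and> spectrum_mellin M s = F s))"

definition transcendental_spectrum :: "real measure \<Rightarrow> bool" where
  "transcendental_spectrum M \<longleftrightarrow> spectrum_in fox_class M \<and> \<not> spectrum_in prony_class M"

definition max_modulus :: "(complex \<Rightarrow> complex) \<Rightarrow> real \<Rightarrow> real" where
  "max_modulus f r = (SUP z\<in>sphere 0 r. norm (f z))"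

definition entire_order :: "(complex \<Rightarrow> complex) \<Rightarrow> ereal" where
  "entire_order f = Limsup at_top (\<lambda>r. ereal (ln (ln (max_modulus f r)) / ln r))"

definition log_normal_spectrum :: "real \<Rightarrow> real \<Rightarrow> real \<Rightarrow> real" where
  "log_normal_spectrum \<mu> \<sigma> \<tau> =
     1 / sqrt (2 * pi * \<sigma>\<^sup>2) * exp (- ((ln \<tau> - \<mu>)\<^sup>2 / (2 * \<sigma>\<^sup>2)))"


lemma function_spectrum_mellin:
  assumes [measurable]: "H \<in> borel_measurable borel" and nn: "\<And>\<tau>. H \<tau> \<ge> 0"
  shows "spectrum_mellin_converges (function_spectrum H) s \<longleftrightarrow> mellin_converges H s"
    and "spectrum_mellin (function_spectrum H) s = mellin H s"
proof -
  have [measurable]: "(\<lambda>\<tau>. indicator {0<..} \<tau> *\<^sub>R complex_of_real \<tau> powr (s - 1)) \<in> borel_measurable borel"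
  proof -
    have "continuous_on {0<..} (\<lambda>\<tau>. complex_of_real \<tau> powr (s - 1))"
      by (intro continuous_intros) (auto simp: complex_nonpos_Reals_iff)
    then show ?thesis
      using borel_measurable_continuous_on_indicator[of "{0<..}"] by auto
  qed
  have eq: "H \<tau> *\<^sub>R (indicator {0<..} \<tau> *\<^sub>R complex_of_real \<tau> powr (s - 1)) =
      indicator {0<..} \<tau> *\<^sub>R (complex_of_real \<tau> powr (s - 1) * complex_of_real (H \<tau>))" for \<tau>
    by (simp add: scaleR_conv_of_real)
  show "spectrum_mellin_converges (function_spectrum H) s \<longleftrightarrow> mellin_converges H s"
    unfolding spectrum_mellin_converges_def mellin_converges_def function_spectrum_def set_integrable_def
    by (subst integrable_density) (simp_all only: eq, auto simp: nn)
  show "spectrum_mellin (function_spectrum H) s = mellin H s"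
    unfolding spectrum_mellin_def mellin_def function_spectrum_def set_lebesgue_integral_def
    by (subst integral_density) (simp_all only: eq, auto simp: nn)
qed

lemma discrete_spectrum_mellin:
  assumes "\<And>k. k < N \<Longrightarrow> g k > 0"
  shows "spectrum_mellin_converges (discrete_spectrum N g l) s"
    and "spectrum_mellin (discrete_spectrum N g l) s =
           (\<Sum>k<N. complex_of_real (g k) * exp (complex_of_real (l k) * s))"
proof -
  have m: "(\<lambda>\<tau>. indicator {0<..} \<tau> *\<^sub>R complex_of_real \<tau> powr (s - 1)) \<in> borel_measurable borel"
  proof -
    have "continuous_on {0<..} (\<lambda>\<tau>. complex_of_real \<tau> powr (s - 1))"
      by (intro continuous_intros) (auto simp: complex_nonpos_Reals_iff)
    then show ?thesis
      using borel_measurable_continuous_on_indicator[of "{0<..}"] by auto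
  qed
  have e: "(\<lambda>k. exp (l k)) \<in> measurable (point_measure {..<N} (\<lambda>k. ennreal (g k * exp (l k)))) borel"
    by simp
  show "spectrum_mellin_converges (discrete_spectrum N g l) s"
    unfolding spectrum_mellin_converges_def discrete_spectrum_def set_integrable_def
    by (subst integrable_distr_eq[OF e m]) (auto intro!: integrable_point_measure_finite)
  have p: "exp (l k) *\<^sub>R complex_of_real (exp (l k)) powr (s - 1) = exp (complex_of_real (l k) * s)" for k
  proof -
    have "exp (l k) *\<^sub>R complex_of_real (exp (l k)) powr (s - 1) =
        exp (complex_of_real (l k)) * exp ((s - 1) * complex_of_real (l k))"
      by (simp add: powr_def scaleR_conv_of_real Ln_of_real exp_of_real del: of_real_exp)
    also have "\<dots> = exp (complex_of_real (l k) * s)"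
      unfolding exp_add[symmetric] by (simp add: algebra_simps)
    finally show ?thesis .
  qed
  have "spectrum_mellin (discrete_spectrum N g l) s =
      (\<Sum>k<N. (g k * exp (l k)) *\<^sub>R complex_of_real (exp (l k)) powr (s - 1))"
    unfolding spectrum_mellin_def discrete_spectrum_def set_lebesgue_integral_def
    using assms
    by (subst integral_distr[OF e m]) (subst lebesgue_integral_point_measure_finite, auto simp: less_imp_le)
  also have "\<dots> = (\<Sum>k<N. complex_of_real (g k) * exp (complex_of_real (l k) * s))"
    using p by (intro sum.cong refl) (metis scaleR_conv_of_real scaleR_scaleR)
  finally show "spectrum_mellin (discrete_spectrum N g l) s =
           (\<Sum>k<N. complex_of_real (g k) * exp (complex_of_real (l k) * s))" .
qed

lemma discrete_spectrum_in_prony_class: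
  assumes "\<And>k. k < N \<Longrightarrow> g k > 0"
  shows "spectrum_in prony_class (discrete_spectrum N g l)"
  unfolding spectrum_in_def
proof (intro bexI exI conjI allI impI)
  show "(0::real) < 1" by simp
  show "(\<lambda>s. \<Sum>k<N. complex_of_real (g k) * exp (complex_of_real (l k) * s)) \<in> prony_class"
    using assms by (auto simp: prony_class_def)
qed (use discrete_spectrum_mellin[OF assms] in auto)

end

(* Substituting \<tau> = exp u turns the Mellin transform of the log-normal spectrum into the
   bilateral exponential transform of a Gaussian. The real part of s is absorbed by completing
   the square, which shifts the mean by \<sigma>\<^sup>2 * Re s, and the imaginary part is the argument of
   the characteristic function of the normal distribution. A finite exponential sum that agrees
   with exp (\<mu> * s + \<sigma>\<^sup>2 / 2 * s\<^sup>2) on a strip agrees with it everywhere, but it grows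
   only exponentially along the positive real axis. *)

theory Submission
  imports Defs "HOL-Probability.Characteristic_Functions" "HOL-Real_Asymp.Real_Asymp"
begin

text \<open>The known characteristic function of the standard normal distribution, with the density
  moved from the measure into the integrand. Integrability holds because \<open>iexp\<close> has
  modulus 1, so the density dominates.\<close>

lemma has_bochner_integral_std_normal_iexp:
  "has_bochner_integral lborel
     (\<lambda>x. std_normal_density x *\<^sub>R iexp (t * x)) (complex_of_real (exp (- t\<^sup>2 / 2)))"
proof (rule has_bochner_integral_iff[THEN iffD2], rule conjI)
  have m: "(\<lambda>x. iexp (t * x)) \<in> borel_measurable lborel" by measurable
  show "integrable lborel (\<lambda>x. std_normal_density x *\<^sub>R iexp (t * x))"
    by (rule Bochner_Integration.integrable_bound[OF integrable_normal_density[of 1 0]]) auto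
  show "(LINT x|lborel. std_normal_density x *\<^sub>R iexp (t * x)) = complex_of_real (exp (- t\<^sup>2 / 2))"
    using fun_cong[OF char_std_normal_distribution, of t] m
    by (simp add: char_def integral_density)
qed

lemma log_normal_mellin:
  fixes \<mu> \<sigma> :: real and s :: complex
  assumes "\<sigma> \<noteq> 0"
  shows "mellin_converges (log_normal_spectrum \<mu> \<sigma>) s" (is ?conv)
    and "mellin (log_normal_spectrum \<mu> \<sigma>) s =
           exp (complex_of_real \<mu> * s + complex_of_real (\<sigma>\<^sup>2 / 2) * s\<^sup>2)" (is "_ = ?E")
proof -
  \<comment> \<open>The sign of \<sigma> is not fixed; \<open>d\<close> is the positive standard
    deviation.\<close>
  define d where "d = \<bar>\<sigma>\<bar>"
  have d: "d > 0" "\<sigma>\<^sup>2 = d\<^sup>2" using assms by (auto simp: d_def)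
  \<comment> \<open>The mean of the Gaussian after tilting by \<open>exp (Re s * u)\<close>. The map
    \<open>g\<close> below combines \<tau> = exp u with the standardisation u = \<nu> + d * x, and
    \<open>C\<close> is the factor free of x that remains after completing the square.\<close>
  define \<nu> where "\<nu> = \<mu> + d\<^sup>2 * Re s"
  define f where "f = (\<lambda>\<tau>. complex_of_real \<tau> powr (s - 1) *
                         complex_of_real (log_normal_spectrum \<mu> \<sigma> \<tau>))"
  define g where "g = (\<lambda>x. exp (\<nu> + d * x))"
  define C where "C = exp (s * complex_of_real \<nu> - complex_of_real (d\<^sup>2 * (Re s)\<^sup>2 / 2))"

  \<comment> \<open>The factor \<open>d * g x\<close> is the derivative of \<open>g\<close>; its
    part \<open>g x\<close> raises the power s - 1 to s.\<close>
  have subst: "\<bar>d * g x\<bar> *\<^sub>R f (g x) = C * (std_normal_density x *\<^sub>R iexp (Im s * d * x))" for x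
  proof -
    define u where "u = \<nu> + d * x"
    have sqrt: "sqrt (2 * pi * d\<^sup>2) = sqrt (2 * pi) * d"
      using d by (simp add: real_sqrt_mult)
    have H: "log_normal_spectrum \<mu> \<sigma> (g x) =
        1 / (sqrt (2 * pi) * d) * exp (- ((d * Re s + x)\<^sup>2 / 2))"
    proof -
      have "(u - \<mu>)\<^sup>2 / (2 * d\<^sup>2) = (d * Re s + x)\<^sup>2 / 2"
        using d by (simp add: u_def \<nu>_def field_simps power2_eq_square)
      then show ?thesis
        by (simp add: log_normal_spectrum_def g_def d(2) sqrt flip: u_def)
    qed
    have P: "complex_of_real (g x) * complex_of_real (g x) powr (s - 1) = exp (s * complex_of_real u)"
    proof -
      have "complex_of_real (g x) powr (s - 1) = exp ((s - 1) * complex_of_real u)"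
        by (simp add: g_def powr_def Ln_of_real u_def del: of_real_exp of_real_add of_real_mult)
      moreover have "complex_of_real (g x) = exp (complex_of_real u)"
        by (simp only: g_def u_def exp_of_real)
      ultimately show ?thesis
        by (simp add: algebra_simps flip: exp_add)
    qed
    have E: "exp (s * complex_of_real u) * complex_of_real (exp (- ((d * Re s + x)\<^sup>2 / 2))) =
        C * (complex_of_real (exp (- x\<^sup>2 / 2)) * iexp (Im s * d * x))"
    proof -
      \<comment> \<open>The real term \<open>d * Re s * x\<close> of s * u cancels against the cross
        term of the square, so only the imaginary part of s stays coupled to x.\<close>
      have "s * complex_of_real u + complex_of_real (- ((d * Re s + x)\<^sup>2 / 2)) =
          s * complex_of_real \<nu> - complex_of_real (d\<^sup>2 * (Re s)\<^sup>2 / 2) +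
          (complex_of_real (- x\<^sup>2 / 2) + \<i> * complex_of_real (Im s * d * x))"
        by (simp add: complex_eq_iff u_def field_simps power2_eq_square)
      then show ?thesis
        unfolding C_def by (simp only: exp_of_real[symmetric] exp_add[symmetric])
    qed
    have "\<bar>d * g x\<bar> *\<^sub>R f (g x) = complex_of_real d *
        (complex_of_real (g x) * complex_of_real (g x) powr (s - 1)) *
        complex_of_real (log_normal_spectrum \<mu> \<sigma> (g x))"
      using d by (simp add: f_def g_def abs_mult scaleR_conv_of_real algebra_simps)
    also have "\<dots> = complex_of_real (1 / sqrt (2 * pi)) *
        (exp (s * complex_of_real u) * complex_of_real (exp (- ((d * Re s + x)\<^sup>2 / 2))))"
      unfolding P H using d by simp
    also have "\<dots> = C * (std_normal_density x *\<^sub>R iexp (Im s * d * x))"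
      unfolding E by (simp add: std_normal_density_def scaleR_conv_of_real)
    finally show ?thesis .
  qed

  \<comment> \<open>The separate real and imaginary parts recombine holomorphically, since s squared
    equals 2 * s * Re s minus the squared modulus of s.\<close>
  have C: "C * complex_of_real (exp (- (Im s * d)\<^sup>2 / 2)) = ?E"
  proof -
    have "s * complex_of_real \<nu> - complex_of_real (d\<^sup>2 * (Re s)\<^sup>2 / 2) +
        complex_of_real (- (Im s * d)\<^sup>2 / 2) =
        complex_of_real \<mu> * s + complex_of_real (\<sigma>\<^sup>2 / 2) * s\<^sup>2"
      unfolding d(2) by (simp add: complex_eq_iff \<nu>_def field_simps power2_eq_square)
    then show ?thesis
      unfolding C_def by (simp only: exp_of_real[symmetric] exp_add[symmetric])
  qed

  have hb: "has_bochner_integral lborel (\<lambda>x. \<bar>d * g x\<bar> *\<^sub>R f (g x)) ?E"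
    unfolding subst C[symmetric]
    by (intro has_bochner_integral_mult_right has_bochner_integral_std_normal_iexp)
  \<comment> \<open>The change of variables is stated for the completed measure; passing to it
    preserves integrals of Borel functions.\<close>
  then have "has_bochner_integral lebesgue (\<lambda>x. \<bar>d * g x\<bar> *\<^sub>R f (g x)) ?E"
    by (auto simp: has_bochner_integral_iff integrable_completion integral_completion
             dest: borel_measurable_integrable)
  then have "(\<lambda>x. \<bar>d * g x\<bar> *\<^sub>R f (g x)) absolutely_integrable_on UNIV \<and>
      integral UNIV (\<lambda>x. \<bar>d * g x\<bar> *\<^sub>R f (g x)) = ?E"
    using lebesgue_integral_eq_integral[of UNIV "\<lambda>x. \<bar>d * g x\<bar> *\<^sub>R f (g x)"]
    by (auto simp: has_bochner_integral_iff set_integrable_def lebesgue_on_UNIV_eq)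
  \<comment> \<open>Read from left to right, this carries convergence and value over to the
    half-line together.\<close>
  moreover have "(\<lambda>x. \<bar>d * g x\<bar> *\<^sub>R f (g x)) absolutely_integrable_on UNIV \<and>
      integral UNIV (\<lambda>x. \<bar>d * g x\<bar> *\<^sub>R f (g x)) = ?E \<longleftrightarrow>
      f absolutely_integrable_on g ` UNIV \<and> integral (g ` UNIV) f = ?E"
    using d by (intro has_absolute_integral_change_of_variables_real)
      (auto simp: g_def inj_on_def intro!: derivative_eq_intros)
  moreover have "g ` UNIV = {0<..}"
  proof -
    have "y = g ((ln y - \<nu>) / d)" if "y > 0" for y
      using that d by (simp add: g_def)
    moreover have "g x > 0" for x
      by (simp add: g_def)
    ultimately show ?thesis by blast
  qed
  ultimately have abs: "f absolutely_integrable_on {0<..}" and int: "integral {0<..} f = ?E"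
    by simp_all

  \<comment> \<open>Borel measurability is what permits the return from \<open>lebesgue\<close> to
    \<open>lborel\<close>.\<close>
  have meas: "(\<lambda>\<tau>. indicator {0<..} \<tau> *\<^sub>R f \<tau>) \<in> borel_measurable borel"
  proof -
    have "continuous_on {0<..} f"
      unfolding f_def log_normal_spectrum_def using assms
      by (intro continuous_intros) (auto simp: complex_nonpos_Reals_iff)
    then show ?thesis
      by (intro borel_measurable_continuous_on_indicator) auto
  qed
  then have *: "set_integrable lborel {0<..} f"
    using abs by (simp add: set_integrable_def integrable_completion)
  then show ?conv
    by (simp add: mellin_converges_def f_def)
  show "mellin (log_normal_spectrum \<mu> \<sigma>) s = ?E"
    using set_borel_integral_eq_integral(2)[OF *] int by (simp add: mellin_def f_def)
qed

text \<open>The triangle inequality bounds the real part of the exponent. The bound is attained on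
  the real axis, at r or -r according to the sign of m, because the quadratic term is the same at
  both points.\<close>

lemma max_modulus_exp_quadratic:
  fixes m c r :: real
  assumes "c \<ge> 0" "r \<ge> 0"
  shows "max_modulus (\<lambda>s. exp (complex_of_real m * s + complex_of_real c * s\<^sup>2)) r =
           exp (\<bar>m\<bar> * r + c * r\<^sup>2)"
  unfolding max_modulus_def
proof (rule cSup_eq_maximum)
  define z where "z = complex_of_real (if m \<ge> 0 then r else - r)"
  have "norm (exp (complex_of_real m * z + complex_of_real c * z\<^sup>2)) = exp (\<bar>m\<bar> * r + c * r\<^sup>2)"
    by (simp add: z_def power2_eq_square)
  moreover have "z \<in> sphere 0 r"
    using assms by (auto simp: z_def)
  ultimately show "exp (\<bar>m\<bar> * r + c * r\<^sup>2) \<in>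
      (\<lambda>z. norm (exp (complex_of_real m * z + complex_of_real c * z\<^sup>2))) ` sphere 0 r"
    by (metis (mono_tags, lifting) image_eqI)
next
  fix y
  assume "y \<in> (\<lambda>z. norm (exp (complex_of_real m * z + complex_of_real c * z\<^sup>2))) ` sphere 0 r"
  then obtain z where z: "norm z = r"
    and y: "y = norm (exp (complex_of_real m * z + complex_of_real c * z\<^sup>2))"
    by auto
  have "Re (complex_of_real m * z + complex_of_real c * z\<^sup>2) \<le>
      norm (complex_of_real m * z) + norm (complex_of_real c * z\<^sup>2)"
    using complex_Re_le_cmod norm_triangle_ineq order_trans by blast
  also have "\<dots> = \<bar>m\<bar> * r + c * r\<^sup>2"
    using assms z by (simp add: norm_mult norm_power)
  finally show "y \<le> exp (\<bar>m\<bar> * r + c * r\<^sup>2)"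
    by (simp add: y)
qed

text \<open>The logarithm of the maximum modulus is a polynomial in r of degree 2, so the quotient
  defining the order converges to 2, and its Limsup is that limit.\<close>

lemma entire_order_exp_quadratic:
  fixes m c :: real
  assumes "c > 0"
  shows "entire_order (\<lambda>s. exp (complex_of_real m * s + complex_of_real c * s\<^sup>2)) = 2"
proof -
  have "((\<lambda>r. ln (\<bar>m\<bar> * r + c * r\<^sup>2) / ln r) \<longlongrightarrow> 2) at_top"
    using assms by real_asymp
  moreover have "eventually (\<lambda>r. ln (\<bar>m\<bar> * r + c * r\<^sup>2) / ln r =
      ln (ln (max_modulus (\<lambda>s. exp (complex_of_real m * s + complex_of_real c * s\<^sup>2)) r)) / ln r) at_top"
    using eventually_ge_at_top[of 0]
    by eventually_elim (use assms in \<open>simp add: max_modulus_exp_quadratic\<close>)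
  ultimately have "((\<lambda>r. ln (ln (max_modulus
      (\<lambda>s. exp (complex_of_real m * s + complex_of_real c * s\<^sup>2)) r)) / ln r) \<longlongrightarrow> 2) at_top"
    by (rule Lim_transform_eventually)
  then show ?thesis
    unfolding entire_order_def by (intro lim_imp_Limsup) (auto dest: tendsto_ereal)
qed

lemma exp_sum_neq_exp_quadratic_on_strip:
  fixes g l :: "'a \<Rightarrow> real" and m c \<alpha> \<beta> :: real
  assumes "c > 0" "\<alpha> < \<beta>"
  shows "\<exists>s. \<alpha> < Re s \<and> Re s < \<beta> \<and>
     (\<Sum>k\<in>A. complex_of_real (g k) * exp (complex_of_real (l k) * s)) \<noteq>
     exp (complex_of_real m * s + complex_of_real c * s\<^sup>2)"
proof (rule ccontr)
  define F where "F = (\<lambda>s. (\<Sum>k\<in>A. complex_of_real (g k) * exp (complex_of_real (l k) * s)) -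
     exp (complex_of_real m * s + complex_of_real c * s\<^sup>2))"
  define U where "U = {s. \<alpha> < Re s \<and> Re s < \<beta>}"
  assume "\<not> ?thesis"
  then have F0: "F s = 0" if "s \<in> U" for s
    using that by (auto simp: F_def U_def)
  have "open U"
    unfolding U_def by (intro open_Collect_conj open_Collect_less continuous_intros)
  \<comment> \<open>Any point of the open strip is a limit point of it, as the identity theorem
    requires; the midpoint serves.\<close>
  moreover have "complex_of_real ((\<alpha> + \<beta>) / 2) \<in> U"
    using assms by (simp add: U_def)
  ultimately have "complex_of_real ((\<alpha> + \<beta>) / 2) islimpt U"
    by (simp add: interior_limit_point interior_open)
  moreover have "F holomorphic_on UNIV"
    unfolding F_def by (intro holomorphic_intros)
  ultimately have "F s = 0" for s
    using analytic_continuation[of F UNIV U _ s] F0 by auto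
  \<comment> \<open>On the real axis the identity becomes one between real functions, whose growth
    can be compared.\<close>
  from this[of "complex_of_real _"]
  have "complex_of_real (\<Sum>k\<in>A. g k * exp (l k * x)) = complex_of_real (exp (m * x + c * x\<^sup>2))" for x
    by (simp add: F_def exp_of_real flip: of_real_mult of_real_add of_real_power)
  then have eq: "(\<Sum>k\<in>A. g k * exp (l k * x)) = exp (m * x + c * x\<^sup>2)" for x
    by (simp only: of_real_eq_iff)
  \<comment> \<open>As c > 0, the quadratic exponent outgrows every linear one, whatever the sign of
    \<open>l k - m\<close>.\<close>
  have "((\<lambda>x. g k * exp (l k * x) / exp (m * x + c * x\<^sup>2)) \<longlongrightarrow> 0) at_top" for k
  proof -
    have "((\<lambda>x. exp ((l k - m) * x - c * x\<^sup>2)) \<longlongrightarrow> 0) at_top"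
      using assms by real_asymp
    then have "((\<lambda>x. g k * exp ((l k - m) * x - c * x\<^sup>2)) \<longlongrightarrow> 0) at_top"
      by (rule tendsto_mult_right_zero)
    moreover have "exp ((l k - m) * x - c * x\<^sup>2) = exp (l k * x) / exp (m * x + c * x\<^sup>2)" for x
      by (simp add: algebra_simps flip: exp_diff)
    ultimately show ?thesis
      by simp
  qed
  then have "((\<lambda>x. \<Sum>k\<in>A. g k * exp (l k * x) / exp (m * x + c * x\<^sup>2)) \<longlongrightarrow> (\<Sum>k\<in>A. 0)) at_top"
    by (rule tendsto_sum)
  \<comment> \<open>By \<open>eq\<close> the sum of these quotients is constantly 1.\<close>
  then have "((\<lambda>x::real. 1::real) \<longlongrightarrow> 0) at_top"
    by (simp add: eq flip: sum_divide_distrib)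
  then show False
    by (simp add: tendsto_const_iff)
qed

theorem proposition8:
  fixes \<mu> \<sigma> :: real
  assumes "\<sigma>\<^sup>2 > 0"
  shows "(\<forall>s. mellin_converges (log_normal_spectrum \<mu> \<sigma>) s \<and>
            mellin (log_normal_spectrum \<mu> \<sigma>) s =
              exp (complex_of_real \<mu> * s + complex_of_real (\<sigma>\<^sup>2 / 2) * s\<^sup>2))
       \<and> mellin (log_normal_spectrum \<mu> \<sigma>) holomorphic_on UNIV
       \<and> entire_order (mellin (log_normal_spectrum \<mu> \<sigma>)) = 2
       \<and> \<not> spectrum_in prony_class (function_spectrum (log_normal_spectrum \<mu> \<sigma>))
       \<and> transcendental_spectrum (function_spectrum (log_normal_spectrum \<mu> \<sigma>))"
proof -
  let ?H = "log_normal_spectrum \<mu> \<sigma>"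
  let ?P = "\<lambda>s. complex_of_real \<mu> * s + complex_of_real (\<sigma>\<^sup>2 / 2) * s\<^sup>2"
  have \<sigma>: "\<sigma> \<noteq> 0" using assms by auto
  have conv: "mellin_converges ?H s" for s
    by (rule log_normal_mellin(1)[OF \<sigma>])
  have mel: "mellin ?H = (\<lambda>s. exp (?P s))"
    by (rule ext) (rule log_normal_mellin(2)[OF \<sigma>])
  have hol: "mellin ?H holomorphic_on UNIV"
    unfolding mel by (intro holomorphic_intros)
  have ord: "entire_order (mellin ?H) = 2"
    unfolding mel by (rule entire_order_exp_quadratic) (use assms in simp)
  have "?H \<in> borel_measurable borel"
    unfolding log_normal_spectrum_def[abs_def] by measurable
  moreover have "?H \<tau> \<ge> 0" for \<tau>
    by (simp add: log_normal_spectrum_def)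
  \<comment> \<open>Nonnegativity ensures that \<open>ennreal\<close> truncates nothing, so the
    measure has the same transform as the function.\<close>
  ultimately have spec: "spectrum_mellin_converges (function_spectrum ?H) s"
    "spectrum_mellin (function_spectrum ?H) s = exp (?P s)" for s
    using function_spectrum_mellin conv by (simp_all add: mel)
  have fox: "spectrum_in fox_class (function_spectrum ?H)"
    unfolding spectrum_in_def
  proof (intro bexI exI conjI allI impI)
    \<comment> \<open>The transform converges on the whole plane, so the choice of strip is
      arbitrary.\<close>
    show "(0::real) < 1" by simp
    have "?P holomorphic_on UNIV" by (intro holomorphic_intros)
    \<comment> \<open>With no Gamma factors both products are empty and the quotient is 1, so the
      exponential of an entire function lies in the Fox class.\<close>
    moreover have "(\<lambda>s. exp (?P s)) = (\<lambda>s. gamma_quotient 0 a b 0 c d s * exp (?P s))" for a b c d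
      by (simp add: gamma_quotient_def)
    ultimately show "(\<lambda>s. exp (?P s)) \<in> fox_class"
      unfolding fox_class_def by blast
  qed (simp_all only: spec)
  have prony: "\<not> spectrum_in prony_class (function_spectrum ?H)"
  proof
    assume "spectrum_in prony_class (function_spectrum ?H)"
    then obtain N :: nat and g l :: "nat \<Rightarrow> real" and \<alpha> \<beta> where "\<alpha> < \<beta>"
      and "\<And>s. \<alpha> < Re s \<Longrightarrow> Re s < \<beta> \<Longrightarrow>
        exp (?P s) = (\<Sum>k<N. complex_of_real (g k) * exp (complex_of_real (l k) * s))"
      unfolding spectrum_in_def prony_class_def spec by auto
    then show False
      using exp_sum_neq_exp_quadratic_on_strip[where c = "\<sigma>\<^sup>2 / 2" and \<alpha> = \<alpha> and \<beta> = \<beta>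
          and A = "{..<N}" and g = g and l = l and m = \<mu>] assms by auto
  qed
  show ?thesis
    using conv fox prony hol ord mel by (simp add: transcendental_spectrum_def)
qed

end
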